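(* Let $\varepsilon\ge0$. Two compact ultrametric spaces $(X,u_X)$ and $(Y,u_Y)$ are $\varepsilon$-interleaved if and only if there exist set maps $\varphi:X\to Y$ and $\psi:Y\to X$ such that for all $x,x'\in X$ and $y,y'\in Y$: 1. $u_Y(\varphi(x),\varphi(x'))\leq u_X(x,x')+\varepsilon$ and $u_X(\psi(y),\psi(y'))\leq u_Y(y,y')+\varepsilon$; 2. $u_X(x,\psi\circ\varphi(x))\leq 2\varepsilon$ and $u_Y(y,\varphi\circ\psi(y))\leq 2\varepsilon$.
   Context: An ultrametric space $(X,u_X)$ is a metric space with $u_X(x,x'')\le\max(u_X(x,x'),u_X(x',x''))$. The dendrogram associated with a compact ultrametric space $(X,u_X)$ is the map $\theta_X$ assigning to each $t\ge0$ the partition $\theta_X(t)$ of $X$ into equivalence classes of the relation $u_X(x,x')\le t$; the block of $\theta_X(t)$ containing $x$ is denoted $[x]^{\theta_X}_t=\{x':u_X(x,x')\le t\}$. Two dendrograms $(X,\theta_X)$, $(Y,\theta_Y)$ are $\varepsilon$-interleaved ($\varepsilon\ge0$) if there exist set maps $\varphi:X\to Y$, $\psi:Y\to X$ such that for all $t\ge0$, $x\in X$, $y\in Y$: (1) $\varphi([x]^{\theta_X}_t)\subseteq[\varphi(x)]^{\theta_Y}_{t+\varepsilon}$ and $\psi([y]^{\theta_Y}_t)\subseteq[\psi(y)]^{\theta_X}_{t+\varepsilon}$; (2) $\psi\circ\varphi([x]^{\theta_X}_t)\subseteq[x]^{\theta_X}_{t+2\varepsilon}$ and $\varphi\circ\psi([y]^{\theta_Y}_t)\subseteq[y]^{\theta_Y}_{t+2\varepsilon}$.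 Two compact ultrametric spaces are called $\varepsilon$-interleaved if their associated dendrograms are $\varepsilon$-interleaved. *)

theory Defs
  imports "HOL-Analysis.Abstract_Metric_Spaces" "HOL-Library.Disjoint_Sets"
begin

locale ultrametric_space = Metric_space M d for M :: "'a set" and d :: "'a \<Rightarrow> 'a \<Rightarrow> real" +
  assumes ultrametric:
    "\<lbrakk>x \<in> M; x' \<in> M; x'' \<in> M\<rbrakk> \<Longrightarrow> d x x'' \<le> max (d x x') (d x' x'')"

locale compact_ultrametric_space = ultrametric_space +
  assumes compact: "compact_space mtopology"

text \<open>Only the values at nonnegative parameters are meaningful; a dendrogram is represented as a
  map from all reals to families of sets.\<close>

definition dendrogram_of :: "'a set \<Rightarrow> ('a \<Rightarrow> 'a \<Rightarrow> real) \<Rightarrow> real \<Rightarrow> 'a set set" where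
  "dendrogram_of X u t = X // {(x, x'). x \<in> X \<and> x' \<in> X \<and> u x x' \<le> t}"

definition block :: "(real \<Rightarrow> 'a set set) \<Rightarrow> real \<Rightarrow> 'a \<Rightarrow> 'a set" where
  "block \<theta> t x = (THE B. B \<in> \<theta> t \<and> x \<in> B)"

definition dendrograms_interleaved ::
  "real \<Rightarrow> 'a set \<Rightarrow> (real \<Rightarrow> 'a set set) \<Rightarrow> 'b set \<Rightarrow> (real \<Rightarrow> 'b set set) \<Rightarrow> bool" where
  "dendrograms_interleaved \<epsilon> X \<theta>\<^sub>X Y \<theta>\<^sub>Y \<longleftrightarrow>
    (\<exists>\<phi> \<in> X \<rightarrow> Y. \<exists>\<psi> \<in> Y \<rightarrow> X. \<forall>t\<ge>0. \<forall>x\<in>X. \<forall>y\<in>Y.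
      \<phi> ` block \<theta>\<^sub>X t x \<subseteq> block \<theta>\<^sub>Y (t + \<epsilon>) (\<phi> x) \<and>
      \<psi> ` block \<theta>\<^sub>Y t y \<subseteq> block \<theta>\<^sub>X (t + \<epsilon>) (\<psi> y) \<and>
      (\<psi> \<circ> \<phi>) ` block \<theta>\<^sub>X t x \<subseteq> block \<theta>\<^sub>X (t + 2 * \<epsilon>) x \<and>
      (\<phi> \<circ> \<psi>) ` block \<theta>\<^sub>Y t y \<subseteq> block \<theta>\<^sub>Y (t + 2 * \<epsilon>) y)"

definition ultrametrics_interleaved ::
  "real \<Rightarrow> 'a set \<Rightarrow> ('a \<Rightarrow> 'a \<Rightarrow> real) \<Rightarrow> 'b set \<Rightarrow> ('b \<Rightarrow> 'b \<Rightarrow> real) \<Rightarrow> bool" where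
  "ultrametrics_interleaved \<epsilon> X u\<^sub>X Y u\<^sub>Y \<longleftrightarrow>
    dendrograms_interleaved \<epsilon> X (dendrogram_of X u\<^sub>X) Y (dendrogram_of Y u\<^sub>Y)"

context ultrametric_space
begin

lemma equiv_dendrogram:
  assumes "0 \<le> t"
  shows "equiv M {(x, x'). x \<in> M \<and> x' \<in> M \<and> d x x' \<le> t}"
proof (rule equivI)
  show "refl_on M {(x, x'). x \<in> M \<and> x' \<in> M \<and> d x x' \<le> t}"
    using assms by (auto simp: refl_on_def)
  show "sym {(x, x'). x \<in> M \<and> x' \<in> M \<and> d x x' \<le> t}"
    by (auto simp: sym_def commute)
  show "trans {(x, x'). x \<in> M \<and> x' \<in> M \<and> d x x' \<le> t}"
  proof (rule transI, clarsimp)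
    fix x y z assume "x \<in> M" "y \<in> M" "z \<in> M" "d x y \<le> t" "d y z \<le> t"
    then show "d x z \<le> t" using ultrametric[of x y z] by simp
  qed
qed auto

lemma partition_on_dendrogram_of:
  assumes "0 \<le> t"
  shows "partition_on M (dendrogram_of M d t)"
  unfolding dendrogram_of_def by (rule partition_on_quotient[OF equiv_dendrogram[OF assms]])

lemma block_dendrogram_of:
  assumes "0 \<le> t" "x \<in> M"
  shows "block (dendrogram_of M d) t x = {x' \<in> M. d x x' \<le> t}"
proof -
  let ?R = "{(x, x'). x \<in> M \<and> x' \<in> M \<and> d x x' \<le> t}"
  have R: "equiv M ?R" by (rule equiv_dendrogram[OF assms(1)])
  have "block (dendrogram_of M d) t x = ?R `` {x}"
    unfolding block_def
  proof (rule the_equality)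
    show "?R `` {x} \<in> dendrogram_of M d t \<and> x \<in> ?R `` {x}"
      unfolding dendrogram_of_def
      using quotientI[OF assms(2)] equiv_class_self[OF R assms(2)] by (rule conjI)
  next
    fix B assume B: "B \<in> dendrogram_of M d t \<and> x \<in> B"
    then obtain z where "B = ?R `` {z}" "(z, x) \<in> ?R"
      by (auto simp: dendrogram_of_def elim!: quotientE)
    then show "B = ?R `` {x}" using equiv_class_eq[OF R] by simp
  qed
  also have "\<dots> = {x' \<in> M. d x x' \<le> t}" using assms(2) by auto
  finally show ?thesis .
qed

end

end

theory Submission
  imports Defs
begin

text \<open>For t \<ge> 0 the block of x at level t is the closed ball of radius t around x
  (\<open>block_dendrogram_of\<close>), so each containment of blocks, taken over all t, is a family
  of metric inequalities. Condition (1) for a map is equivalent to its distortion bound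
  (\<open>image_block_subset_iff\<close>), and condition (2) for a composite to its displacement
  bound (\<open>image_block_subset_same_block_iff\<close>). Hence the same pair \<phi>, \<psi>
  serves both sides, and what remains is to separate the joint quantifiers over X and Y.\<close>

lemma image_block_subset_iff:
  assumes X: "ultrametric_space X u" and Y: "ultrametric_space Y v"
    and f: "f \<in> X \<rightarrow> Y" and "0 \<le> \<delta>"
  shows "(\<forall>t\<ge>0. \<forall>x\<in>X. f ` block (dendrogram_of X u) t x \<subseteq> block (dendrogram_of Y v) (t + \<delta>) (f x))
    \<longleftrightarrow> (\<forall>x\<in>X. \<forall>x'\<in>X. v (f x) (f x') \<le> u x x' + \<delta>)" (is "?L \<longleftrightarrow> ?R")
proof -
  interpret X: ultrametric_space X u by (fact X)
  interpret Y: ultrametric_space Y v by (fact Y)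
  \<comment> \<open>With \<open>0 \<le> \<delta>\<close> the level t + \<delta> stays nonnegative,
    so the target block is a closed ball as well.\<close>
  have "?L \<longleftrightarrow> (\<forall>t\<ge>0. \<forall>x\<in>X. \<forall>x'\<in>X. u x x' \<le> t \<longrightarrow> v (f x) (f x') \<le> t + \<delta>)"
    using f \<open>0 \<le> \<delta>\<close>
    by (simp add: X.block_dendrogram_of Y.block_dendrogram_of Pi_iff image_subset_iff Ball_def imp_conjL)
  \<comment> \<open>Left to right is the sharpest case t = \<open>u x x'\<close>; the converse is
    monotonicity of adding \<delta>.\<close>
  also have "\<dots> \<longleftrightarrow> ?R"
    by (auto intro: order.trans[OF _ add_right_mono])
  finally show ?thesis .
qed

text \<open>The block of x at level 0 already contains x, which gives the displacement bound; the
  triangle inequality spreads that bound to every level. It is applied to the two composites with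
  \<delta> = 2\<epsilon>.\<close>

lemma image_block_subset_same_block_iff:
  assumes X: "ultrametric_space X u" and f: "f \<in> X \<rightarrow> X" and "0 \<le> \<delta>"
  shows "(\<forall>t\<ge>0. \<forall>x\<in>X. f ` block (dendrogram_of X u) t x \<subseteq> block (dendrogram_of X u) (t + \<delta>) x)
    \<longleftrightarrow> (\<forall>x\<in>X. u x (f x) \<le> \<delta>)" (is "?L \<longleftrightarrow> ?R")
proof -
  interpret X: ultrametric_space X u by (fact X)
  have "?L \<longleftrightarrow> (\<forall>t\<ge>0. \<forall>x\<in>X. \<forall>x'\<in>X. u x x' \<le> t \<longrightarrow> u x (f x') \<le> t + \<delta>)"
    using f \<open>0 \<le> \<delta>\<close>
    by (simp add: X.block_dendrogram_of Pi_iff image_subset_iff Ball_def imp_conjL)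
  also have "\<dots> \<longleftrightarrow> ?R"
  proof
    assume L: "\<forall>t\<ge>0. \<forall>x\<in>X. \<forall>x'\<in>X. u x x' \<le> t \<longrightarrow> u x (f x') \<le> t + \<delta>"
    show ?R
    proof
      fix x assume "x \<in> X"
      then show "u x (f x) \<le> \<delta>" using L[rule_format, of 0 x x] by simp
    qed
  next
    assume R: ?R
    show "\<forall>t\<ge>0. \<forall>x\<in>X. \<forall>x'\<in>X. u x x' \<le> t \<longrightarrow> u x (f x') \<le> t + \<delta>"
    proof (intro allI impI ballI)
      fix t x x' assume "x \<in> X" "x' \<in> X" "u x x' \<le> t"
      \<comment> \<open>The detour goes through x', where the displacement bound applies.\<close>
      moreover have "u x (f x') \<le> u x x' + u x' (f x')"
        using X.triangle f \<open>x \<in> X\<close> \<open>x' \<in> X\<close> by blast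
      moreover have "u x' (f x') \<le> \<delta>" using R \<open>x' \<in> X\<close> by blast
      ultimately show "u x (f x') \<le> t + \<delta>" by linarith
    qed
  qed
  finally show ?thesis .
qed

theorem theorem6p6:
  fixes X :: "'a set" and u\<^sub>X :: "'a \<Rightarrow> 'a \<Rightarrow> real"
    and Y :: "'b set" and u\<^sub>Y :: "'b \<Rightarrow> 'b \<Rightarrow> real"
    and \<epsilon> :: real
  assumes "0 \<le> \<epsilon>"
    and "compact_ultrametric_space X u\<^sub>X"
    and "compact_ultrametric_space Y u\<^sub>Y"
  shows "ultrametrics_interleaved \<epsilon> X u\<^sub>X Y u\<^sub>Y \<longleftrightarrow>
    (\<exists>\<phi> \<in> X \<rightarrow> Y. \<exists>\<psi> \<in> Y \<rightarrow> X. \<forall>x\<in>X. \<forall>x'\<in>X. \<forall>y\<in>Y. \<forall>y'\<in>Y.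
      (u\<^sub>Y (\<phi> x) (\<phi> x') \<le> u\<^sub>X x x' + \<epsilon> \<and> u\<^sub>X (\<psi> y) (\<psi> y') \<le> u\<^sub>Y y y' + \<epsilon>) \<and>
      (u\<^sub>X x ((\<psi> \<circ> \<phi>) x) \<le> 2 * \<epsilon> \<and> u\<^sub>Y y ((\<phi> \<circ> \<psi>) y) \<le> 2 * \<epsilon>))"
proof -
  have X: "ultrametric_space X u\<^sub>X" and Y: "ultrametric_space Y u\<^sub>Y"
    using assms(2,3) by (simp_all add: compact_ultrametric_space.axioms(1))
  have "0 \<le> 2 * \<epsilon>" using assms(1) by simp
  show ?thesis
    unfolding ultrametrics_interleaved_def dendrograms_interleaved_def
  \<comment> \<open>The equivalence is shown for each fixed pair \<phi>, \<psi>.\<close>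
  proof (intro bex_cong refl)
    fix \<phi> \<psi> assume \<phi>: "\<phi> \<in> X \<rightarrow> Y" and \<psi>: "\<psi> \<in> Y \<rightarrow> X"
    then have \<psi>\<phi>: "\<psi> \<circ> \<phi> \<in> X \<rightarrow> X" and \<phi>\<psi>: "\<phi> \<circ> \<psi> \<in> Y \<rightarrow> Y" by auto
    \<comment> \<open>Maps in both directions force X and Y to be empty together. If just one were
      empty, a joint quantifier over X and Y would be vacuous and could not be split into conditions
      on X and on Y separately.\<close>
    have ne: "X = {} \<longleftrightarrow> Y = {}" using \<phi> \<psi> by auto
    note iffs = image_block_subset_iff[OF X Y \<phi> assms(1)] image_block_subset_iff[OF Y X \<psi> assms(1)]
      image_block_subset_same_block_iff[OF X \<psi>\<phi> \<open>0 \<le> 2 * \<epsilon>\<close>]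
      image_block_subset_same_block_iff[OF Y \<phi>\<psi> \<open>0 \<le> 2 * \<epsilon>\<close>]
    let ?\<theta> = "dendrogram_of X u\<^sub>X" and ?\<eta> = "dendrogram_of Y u\<^sub>Y"
    have "(\<forall>t\<ge>0. \<forall>x\<in>X. \<forall>y\<in>Y.
        \<phi> ` block ?\<theta> t x \<subseteq> block ?\<eta> (t + \<epsilon>) (\<phi> x) \<and>
        \<psi> ` block ?\<eta> t y \<subseteq> block ?\<theta> (t + \<epsilon>) (\<psi> y) \<and>
        (\<psi> \<circ> \<phi>) ` block ?\<theta> t x \<subseteq> block ?\<theta> (t + 2 * \<epsilon>) x \<and>
        (\<phi> \<circ> \<psi>) ` block ?\<eta> t y \<subseteq> block ?\<eta> (t + 2 * \<epsilon>) y) \<longleftrightarrow>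
      (\<forall>t\<ge>0. \<forall>x\<in>X. \<phi> ` block ?\<theta> t x \<subseteq> block ?\<eta> (t + \<epsilon>) (\<phi> x)) \<and>
      (\<forall>t\<ge>0. \<forall>y\<in>Y. \<psi> ` block ?\<eta> t y \<subseteq> block ?\<theta> (t + \<epsilon>) (\<psi> y)) \<and>
      (\<forall>t\<ge>0. \<forall>x\<in>X. (\<psi> \<circ> \<phi>) ` block ?\<theta> t x \<subseteq> block ?\<theta> (t + 2 * \<epsilon>) x) \<and>
      (\<forall>t\<ge>0. \<forall>y\<in>Y. (\<phi> \<circ> \<psi>) ` block ?\<eta> t y \<subseteq> block ?\<eta> (t + 2 * \<epsilon>) y)"
      using ne by (cases "X = {}") (simp_all add: ball_conj_distrib all_conj_distrib imp_conjR ex_in_conv)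
    also have "\<dots> \<longleftrightarrow> (\<forall>x\<in>X. \<forall>x'\<in>X. \<forall>y\<in>Y. \<forall>y'\<in>Y.
        (u\<^sub>Y (\<phi> x) (\<phi> x') \<le> u\<^sub>X x x' + \<epsilon> \<and> u\<^sub>X (\<psi> y) (\<psi> y') \<le> u\<^sub>Y y y' + \<epsilon>) \<and>
        (u\<^sub>X x ((\<psi> \<circ> \<phi>) x) \<le> 2 * \<epsilon> \<and> u\<^sub>Y y ((\<phi> \<circ> \<psi>) y) \<le> 2 * \<epsilon>))"
      unfolding iffs using ne by (cases "X = {}") (simp_all add: ball_conj_distrib ex_in_conv)
    finally show "(\<forall>t\<ge>0. \<forall>x\<in>X. \<forall>y\<in>Y.
        \<phi> ` block ?\<theta> t x \<subseteq> block ?\<eta> (t + \<epsilon>) (\<phi> x) \<and>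
        \<psi> ` block ?\<eta> t y \<subseteq> block ?\<theta> (t + \<epsilon>) (\<psi> y) \<and>
        (\<psi> \<circ> \<phi>) ` block ?\<theta> t x \<subseteq> block ?\<theta> (t + 2 * \<epsilon>) x \<and>
        (\<phi> \<circ> \<psi>) ` block ?\<eta> t y \<subseteq> block ?\<eta> (t + 2 * \<epsilon>) y) \<longleftrightarrow>
      (\<forall>x\<in>X. \<forall>x'\<in>X. \<forall>y\<in>Y. \<forall>y'\<in>Y.
        (u\<^sub>Y (\<phi> x) (\<phi> x') \<le> u\<^sub>X x x' + \<epsilon> \<and> u\<^sub>X (\<psi> y) (\<psi> y') \<le> u\<^sub>Y y y' + \<epsilon>) \<and>
        (u\<^sub>X x ((\<psi> \<circ> \<phi>) x) \<le> 2 * \<epsilon> \<and> u\<^sub>Y y ((\<phi> \<circ> \<psi>) y) \<le> 2 * \<epsilon>))" .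
  qed
qed

end
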